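(* For any instance of \textsc{Best Response} (defined in the context) with an additive utility function of the manipulator, if the manipulator uses its truthful preference ranking $\succ_1$ as its picking strategy, it obtains a bundle whose total utility is at least half of the total utility of the bundle obtained under an optimal picking strategy.
   Context: Sequential allocation: a set $O$ of $m$ indivisible items is allocated to agents $N=\{1,\dots,n\}$ according to a policy $\pi$, a sequence of agents of length $m$. Each agent $i$ has a strict complete preference ranking $\succ_i$ over $O$. Agent 1 is the manipulator and has an additive utility function $u:O\to\mathbb{R}_{>0}$ consistent with $\succ_1$ (i.e. $u(g_x)>u(g_y)$ iff $g_x\succ_1 g_y$). Items are allocated in turns following $\pi$: at a turn of a non-manipulator $i\ge 2$, it takes its most preferred (under $\succ_i$) item not yet allocated. The manipulator uses a picking strategy, i.e. a permutation of $O$, and at each of its turns it takes the first item of this permutation not yet allocated. \textsc{Best Response} asks for a picking strategy maximizing the manipulator's total utility; an optimal picking strategy is one attaining this maximum. *)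

theory Defs
  imports Complex_Main "HOL-Combinatorics.Multiset_Permutations"
begin

text \<open>
  A strict complete ranking of a finite set is the list of its elements, each occurring exactly
  once, with the most preferred element first: an element of \<^const>\<open>permutations_of_set\<close>.
  Picking strategies are the same kind of object.
\<close>

definition prefers :: "'a list \<Rightarrow> 'a \<Rightarrow> 'a \<Rightarrow> bool" where
  "prefers r x y \<longleftrightarrow> (\<exists>i j. i < j \<and> j < length r \<and> r ! i = x \<and> r ! j = y)"

definition first_available :: "'a list \<Rightarrow> 'a set \<Rightarrow> 'a" where
  "first_available r A = hd (filter (\<lambda>x. x \<in> A) r)"

text \<open>
  \<open>agent_bundle r \<pi> A i\<close> is what agent \<open>i\<close> receives when the turns \<open>\<pi>\<close> are played from the set \<open>A\<close> of
  items not yet allocated, each agent \<open>a\<close> picking by the list \<open>r a\<close>.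
\<close>

fun agent_bundle :: "(nat \<Rightarrow> 'a list) \<Rightarrow> nat list \<Rightarrow> 'a set \<Rightarrow> nat \<Rightarrow> 'a set" where
  "agent_bundle r [] A i = {}"
| "agent_bundle r (a # \<pi>) A i =
     (let x = first_available (r a) A
      in (if a = i then {x} else {}) \<union> agent_bundle r \<pi> (A - {x}) i)"

locale best_response =
  fixes n :: nat
    and Items :: "'a set"
    and \<pi> :: "nat list"
    and pref :: "nat \<Rightarrow> 'a list"
    and u :: "'a \<Rightarrow> real"
  assumes agents: "1 \<le> n"
    and finite_Items: "finite Items"
    and policy_agents: "set \<pi> \<subseteq> {1..n}"
    and policy_length: "length \<pi> = card Items"
    and pref_ranking: "\<And>i. i \<in> {1..n} \<Longrightarrow> pref i \<in> permutations_of_set Items"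
    and u_pos: "\<And>x. x \<in> Items \<Longrightarrow> 0 < u x"
    and u_consistent:
      "\<And>x y. x \<in> Items \<Longrightarrow> y \<in> Items \<Longrightarrow> u x > u y \<longleftrightarrow> prefers (pref 1) x y"

definition manipulator_bundle ::
    "'a set \<Rightarrow> nat list \<Rightarrow> (nat \<Rightarrow> 'a list) \<Rightarrow> 'a list \<Rightarrow> 'a set" where
  "manipulator_bundle Items \<pi> pref s = agent_bundle (pref(1 := s)) \<pi> Items 1"

definition manipulator_utility ::
    "'a set \<Rightarrow> nat list \<Rightarrow> (nat \<Rightarrow> 'a list) \<Rightarrow> ('a \<Rightarrow> real) \<Rightarrow> 'a list \<Rightarrow> real" where
  "manipulator_utility Items \<pi> pref u s = (\<Sum>x\<in>manipulator_bundle Items \<pi> pref s. u x)"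

definition optimal_strategy ::
    "'a set \<Rightarrow> nat list \<Rightarrow> (nat \<Rightarrow> 'a list) \<Rightarrow> ('a \<Rightarrow> real) \<Rightarrow> 'a list \<Rightarrow> bool" where
  "optimal_strategy Items \<pi> pref u s \<longleftrightarrow>
     is_arg_max (manipulator_utility Items \<pi> pref u) (\<lambda>t. t \<in> permutations_of_set Items) s"

lemma (in best_response) optimal_strategy_exists: "\<exists>s. optimal_strategy Items \<pi> pref u s"
proof -
  let ?f = "manipulator_utility Items \<pi> pref u" and ?S = "permutations_of_set Items"
  have ne: "?S \<noteq> {}" and fin: "finite ?S"
    using pref_ranking[of 1] agents finite_Items by auto
  have "Max (?f ` ?S) \<in> ?f ` ?S"
    using ne fin by (intro Max_in) auto
  then obtain s where s: "s \<in> ?S" "?f s = Max (?f ` ?S)"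
    by auto
  have "\<not> ?f t > ?f s" if "t \<in> ?S" for t
    using s that fin by (simp add: not_less)
  with s(1) show ?thesis
    unfolding optimal_strategy_def is_arg_max_def by blast
qed

end

theory Submission
  imports Defs
begin

text \<open>
  Suppose the manipulator's first truthful pick is \<open>g\<close>, worth at least as much as any other
  available item, while the optimal strategy picks \<open>o\<close>. Exchanging one available item for
  another lowers the best attainable future utility by at most the largest value of an item: the
  two runs keep differing in one item only, until they merge. So the optimum after picking \<open>o\<close>
  exceeds the optimum after picking \<open>g\<close> by at most \<open>u g\<close>, and the optimum is at most \<open>2 * u g\<close> plus
  the optimum after picking \<open>g\<close>. Induction on the policy gives the factor two.
\<close>

section \<open>Picking the first available item of a list\<close>

lemma first_available_split:
  assumes "A \<subseteq> set r" and "A \<noteq> {}"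
  obtains ys x zs where "r = ys @ x # zs" "set ys \<inter> A = {}" "x \<in> A" "first_available r A = x"
proof -
  from assms have "filter (\<lambda>x. x \<in> A) r \<noteq> []"
    by (auto simp: filter_empty_conv)
  then obtain x xs where x: "filter (\<lambda>x. x \<in> A) r = x # xs"
    by (cases "filter (\<lambda>x. x \<in> A) r") auto
  then have x_eq: "first_available r A = x"
    by (simp add: first_available_def)
  from x obtain ys zs where "r = ys @ x # zs" "\<forall>y\<in>set ys. y \<notin> A" "x \<in> A"
    by (auto simp: filter_eq_Cons_iff)
  then show thesis
    using x_eq by (intro that[of ys x zs]) blast+
qed

lemma first_available_in:
  "A \<subseteq> set r \<Longrightarrow> A \<noteq> {} \<Longrightarrow> first_available r A \<in> A"
  by (metis first_available_split)

text \<open>Whatever precedes the pick from \<open>B\<close> in \<open>r\<close> lies outside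
  \<open>B\<close>, hence outside \<open>A\<close>.\<close>

lemma first_available_subset:
  assumes "A \<subseteq> B" and "B \<subseteq> set r" and "first_available r B \<in> A"
  shows "first_available r A = first_available r B"
proof -
  have "B \<noteq> {}"
    using assms(1,3) by blast
  with assms(2) obtain ys x zs where
    r: "r = ys @ x # zs" "set ys \<inter> B = {}" "x \<in> B" "first_available r B = x"
    by (rule first_available_split)
  then have "filter (\<lambda>x. x \<in> A) ys = []"
    using assms(1) by (auto simp: filter_empty_conv)
  moreover have "x \<in> A"
    using assms(3) r(4) by simp
  ultimately have "first_available r A = x"
    unfolding first_available_def r(1) by simp
  with r(4) show ?thesis
    by simp
qed

lemma first_available_prefers:
  assumes "A \<subseteq> set r" and "y \<in> A" and "y \<noteq> first_available r A"
  shows "prefers r (first_available r A) y"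
proof -
  have "A \<noteq> {}"
    using assms(2) by blast
  with assms(1) obtain ys x zs where
    r: "r = ys @ x # zs" "set ys \<inter> A = {}" "x \<in> A" "first_available r A = x"
    by (rule first_available_split)
  then have "y \<in> set zs"
    using assms by auto
  then obtain k where k: "k < length zs" "zs ! k = y"
    by (auto simp: in_set_conv_nth)
  have "prefers r x y"
    unfolding prefers_def r(1)
    using k by (intro exI[of _ "length ys"] exI[of _ "length ys + Suc k"])
      (simp add: nth_append)
  with r(4) show ?thesis
    by simp
qed

section \<open>Attainable utilities and bundles\<close>

text \<open>
  Agent \<open>i\<close> may pick freely at each of its turns, so the attainable utilities include those of all
  picking strategies, and the list \<open>r i\<close> plays no role.
\<close>

inductive attainable ::
    "(nat \<Rightarrow> 'a list) \<Rightarrow> nat \<Rightarrow> ('a \<Rightarrow> real) \<Rightarrow> nat list \<Rightarrow> 'a set \<Rightarrow> real \<Rightarrow> bool"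
  for r i u where
  Nil: "attainable r i u [] A 0"
| own: "x \<in> A \<Longrightarrow> attainable r i u \<pi> (A - {x}) v \<Longrightarrow> attainable r i u (i # \<pi>) A (u x + v)"
| other: "a \<noteq> i \<Longrightarrow> attainable r i u \<pi> (A - {first_available (r a) A}) v \<Longrightarrow>
    attainable r i u (a # \<pi>) A v"

inductive_cases attainable_NilE: "attainable r i u [] A v"

text \<open>The length bound leaves an item for every turn, so \<open>hd\<close> never meets an
  empty list.\<close>

lemma agent_bundle_subset:
  assumes "finite A" and "length \<pi> \<le> card A" and "\<And>a. a \<in> set \<pi> \<Longrightarrow> A \<subseteq> set (r a)"
  shows "agent_bundle r \<pi> A i \<subseteq> A"
  using assms
proof (induction \<pi> arbitrary: A)
  case (Cons a \<pi>)
  let ?x = "first_available (r a) A"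
  have x: "?x \<in> A"
    using Cons.prems by (intro first_available_in) auto
  have "agent_bundle r \<pi> (A - {?x}) i \<subseteq> A - {?x}"
    using Cons.prems x by (intro Cons.IH) (auto simp: subset_iff)
  with x show ?case
    by (auto simp: Let_def)
qed simp

text \<open>The picked item is removed before the later turns, so the union is disjoint and utility
  adds up.\<close>

lemma sum_agent_bundle_Cons:
  fixes u :: "'a \<Rightarrow> real"
  assumes "finite A" and "length (a # \<pi>) \<le> card A"
    and "\<And>b. b \<in> set (a # \<pi>) \<Longrightarrow> A \<subseteq> set (r b)"
  defines "x \<equiv> first_available (r a) A"
  shows "sum u (agent_bundle r (a # \<pi>) A i) =
    (if a = i then u x else 0) + sum u (agent_bundle r \<pi> (A - {x}) i)"
proof -
  have x: "x \<in> A"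
    unfolding x_def using assms(1-3) by (intro first_available_in) auto
  have sub: "agent_bundle r \<pi> (A - {x}) i \<subseteq> A - {x}"
    using assms(1-3) x by (intro agent_bundle_subset) (auto simp: subset_iff)
  then have "finite (agent_bundle r \<pi> (A - {x}) i)"
    using assms(1) by (auto intro: finite_subset)
  moreover have "x \<notin> agent_bundle r \<pi> (A - {x}) i"
    using sub by blast
  ultimately show ?thesis
    by (simp add: Let_def x_def[symmetric])
qed

text \<open>Following \<open>s\<close> is one way of picking freely, and \<open>r(i := s)\<close>
  agrees with \<open>r\<close> on all other agents.\<close>

lemma agent_bundle_attainable:
  assumes "finite A" and "length \<pi> \<le> card A"
    and "\<And>a. a \<in> set \<pi> \<Longrightarrow> A \<subseteq> set ((r(i := s)) a)"
  shows "attainable r i u \<pi> A (sum u (agent_bundle (r(i := s)) \<pi> A i))"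
  using assms
proof (induction \<pi> arbitrary: A)
  case Nil
  show ?case
    by (simp add: attainable.Nil)
next
  case (Cons a \<pi>)
  let ?x = "first_available ((r(i := s)) a) A"
  have x: "?x \<in> A"
    using Cons.prems by (intro first_available_in) auto
  have IH: "attainable r i u \<pi> (A - {?x}) (sum u (agent_bundle (r(i := s)) \<pi> (A - {?x}) i))"
    using Cons.prems x by (intro Cons.IH) (auto simp: subset_iff)
  have sum: "sum u (agent_bundle (r(i := s)) (a # \<pi>) A i) =
      (if a = i then u ?x else 0) + sum u (agent_bundle (r(i := s)) \<pi> (A - {?x}) i)"
    using Cons.prems by (rule sum_agent_bundle_Cons)
  show ?case
  proof (cases "a = i")
    case True
    with attainable.own[OF x IH] show ?thesis
      unfolding sum by simp
  next
    case False
    with attainable.other[of a i r u] IH show ?thesis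
      unfolding sum by simp
  qed
qed

section \<open>Exchange argument and factor two\<close>

text \<open>The second run copies the manipulator's picks while the available sets differ by one
  exchanged item. A loss arises at most once, when the copied pick is that item and its counterpart
  is taken instead; the sets then coincide.\<close>

lemma attainable_exchange:
  assumes "attainable r i u \<pi> (insert x C) v" and "x \<notin> C" and "y \<notin> C"
    and "\<And>z. z \<in> insert x (insert y C) \<Longrightarrow> 0 \<le> u z \<and> u z \<le> M"
    and "\<And>a. a \<in> set \<pi> \<Longrightarrow> a \<noteq> i \<Longrightarrow> insert x (insert y C) \<subseteq> set (r a)"
  shows "\<exists>w. attainable r i u \<pi> (insert y C) w \<and> v \<le> w + M"
  using assms
proof (induction \<pi> arbitrary: x y C v)
  case Nil
  then have "v = 0"
    by (auto elim: attainable_NilE)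
  moreover have "0 \<le> M"
    using Nil.prems(4)[of x] by simp
  ultimately show ?case
    by (intro exI[of _ 0]) (simp add: attainable.Nil)
next
  case (Cons a \<pi>)
  have bound: "0 \<le> u z \<and> u z \<le> M" if "z \<in> insert x (insert y C)" for z
    using Cons.prems(4) that by blast
  have M: "0 \<le> M"
    using bound[of x] by simp
  \<comment> \<open>This is the induction hypothesis with the sets given up to equality. The new
    pair comes from the old items, so the bound \<open>M\<close> persists.\<close>
  have swap: "\<exists>w. attainable r i u \<pi> A' w \<and> v' \<le> w + M"
    if "attainable r i u \<pi> A v'" "A = insert x' D" "A' = insert y' D" "x' \<notin> D" "y' \<notin> D"
      "insert x' (insert y' D) \<subseteq> insert x (insert y C)" for x' y' D A A' v'
    unfolding that(3)
  proof (rule Cons.IH)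
    show "attainable r i u \<pi> (insert x' D) v'"
      using that(1,2) by simp
    show "0 \<le> u z \<and> u z \<le> M" if "z \<in> insert x' (insert y' D)" for z
      using that \<open>insert x' (insert y' D) \<subseteq> _\<close> by (intro bound) blast
    show "insert x' (insert y' D) \<subseteq> set (r b)" if "b \<in> set \<pi>" "b \<noteq> i" for b
      using \<open>insert x' (insert y' D) \<subseteq> _\<close> Cons.prems(5)[of b] that by auto
  qed (use that in auto)
  from Cons.prems(1) show ?case
  proof cases
    case (own z v')
    show ?thesis
    proof (cases "z = x")
      case True
      \<comment> \<open>Both remaining sets are \<open>C\<close>: the runs merge, at a loss of
        \<open>u x - u y\<close>.\<close>
      then have "attainable r i u \<pi> (insert y C - {y}) v'"
        using own Cons.prems(2,3) by simp
      then have "attainable r i u (a # \<pi>) (insert y C) (u y + v')"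
        using own by (auto intro: attainable.own)
      moreover have "v \<le> u y + v' + M"
        using own True bound[of x] bound[of y] by simp
      ultimately show ?thesis
        by blast
    next
      case False
      with own have z: "z \<in> C"
        by auto
      have "\<exists>w. attainable r i u \<pi> (insert y C - {z}) w \<and> v' \<le> w + M"
        using z Cons.prems(2,3)
        by (intro swap[OF own(4), where x' = x and y' = y and D = "C - {z}"]) auto
      then obtain w where w: "attainable r i u \<pi> (insert y C - {z}) w" "v' \<le> w + M"
        by blast
      then have "attainable r i u (a # \<pi>) (insert y C) (u z + w)"
        using own z by (auto intro: attainable.own)
      with w own show ?thesis
        by (intro exI[of _ "u z + w"]) simp
    qed
  next
    case other
    let ?p = "first_available (r a) (insert x C)" and ?q = "first_available (r a) (insert y C)"
    have sub: "insert x (insert y C) \<subseteq> set (r a)"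
      using Cons.prems(5) other by simp
    have p: "?p \<in> insert x C" and q: "?q \<in> insert y C"
      using sub by (intro first_available_in; blast)+
    \<comment> \<open>Each pick is then also the first item of \<open>C\<close> in
      \<open>r a\<close>.\<close>
    have both_C: "?p = ?q" if "?p \<in> C" "?q \<in> C"
      using that sub first_available_subset[OF subset_insertI, of x C "r a"]
        first_available_subset[OF subset_insertI, of y C "r a"] by simp
    have "\<exists>w. attainable r i u \<pi> (insert y C - {?q}) w \<and> v \<le> w + M"
    proof -
      \<comment> \<open>In the first case the runs merge. If only \<open>x\<close> is taken,
        \<open>?q\<close> becomes the surplus item of the first run; if only \<open>y\<close> is
        taken, \<open>?p\<close> becomes that of the second. In the last case the pair stays
        \<open>x\<close>, \<open>y\<close>.\<close>
      consider "?p = x" "?q = y" | "?p = x" "?q \<in> C" | "?p \<in> C" "?q = y"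
        | "?p \<in> C" "?q \<in> C"
        using p q by blast
      then show ?thesis
      proof cases
        case 1
        then have "insert x C - {?p} = insert y C - {?q}"
          using Cons.prems(2,3) by simp
        with other M show ?thesis
          by (intro exI[of _ v]) simp
      next
        case 2
        show ?thesis
          using 2 Cons.prems(2,3)
          by (intro swap[OF other(2), where x' = "?q" and y' = "y" and D = "C - {?q}"]) auto
      next
        case 3
        show ?thesis
          using 3 Cons.prems(2,3)
          by (intro swap[OF other(2), where x' = "x" and y' = "?p" and D = "C - {?p}"]) auto
      next
        case 4
        with both_C have "?p = ?q"
          by blast
        then show ?thesis
          using 4 Cons.prems(2,3)
          by (intro swap[OF other(2), where x' = "x" and y' = "y" and D = "C - {?p}"]) auto
      qed
    qed
    with other show ?thesis
      by (auto intro: attainable.other)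
  qed
qed

text \<open>Quantifying over all \<open>B \<subseteq> A\<close> in the last hypothesis lets it pass
  to the items left after each turn. Turns of other agents change both sides alike.\<close>

lemma attainable_le_twice_truthful:
  fixes u :: "'a \<Rightarrow> real"
  assumes "attainable r i u \<pi> A v" and "finite A" and "length \<pi> \<le> card A"
    and "\<And>a. a \<in> set \<pi> \<Longrightarrow> A \<subseteq> set (r a)"
    and "\<And>x. x \<in> A \<Longrightarrow> 0 \<le> u x"
    and "\<And>B x. B \<subseteq> A \<Longrightarrow> x \<in> B \<Longrightarrow> u x \<le> u (first_available (r i) B)"
  shows "v \<le> 2 * sum u (agent_bundle r \<pi> A i)"
  using assms
proof (induction \<pi> arbitrary: A v)
  case Nil
  then show ?case
    by (auto elim: attainable_NilE)
next
  case (Cons a \<pi>)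
  let ?g = "first_available (r a) A"
  have g: "?g \<in> A"
    using Cons.prems by (intro first_available_in) auto
  have IH: "w \<le> 2 * sum u (agent_bundle r \<pi> (A - {?g}) i)"
    if "attainable r i u \<pi> (A - {?g}) w" for w
    using that Cons.prems(2-6) g by (intro Cons.IH) (auto simp: subset_iff)
  have sum: "sum u (agent_bundle r (a # \<pi>) A i) =
      (if a = i then u ?g else 0) + sum u (agent_bundle r \<pi> (A - {?g}) i)"
    using Cons.prems(2-4) by (rule sum_agent_bundle_Cons)
  from Cons.prems(1) show ?case
  proof cases
    case (own z v')
    have max: "u x \<le> u ?g" if "x \<in> A" for x
      using Cons.prems(6)[of A x] that own by simp
    have "\<exists>w. attainable r i u \<pi> (A - {?g}) w \<and> v' \<le> w + u ?g"
    proof (cases "z = ?g")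
      case True
      with own Cons.prems(5) g show ?thesis
        by (intro exI[of _ v']) simp
    next
      case False
      let ?C = "A - {?g, z}"
      \<comment> \<open>Picking \<open>z\<close> leaves \<open>?g\<close> and picking
        \<open>?g\<close> leaves \<open>z\<close>, beside the common rest \<open>?C\<close>; the
        exchange is applied with \<open>M = u ?g\<close>.\<close>
      have A: "A - {z} = insert ?g ?C" "A - {?g} = insert z ?C"
        using False g own by auto
      have "\<exists>w. attainable r i u \<pi> (insert z ?C) w \<and> v' \<le> w + u ?g"
      proof (rule attainable_exchange)
        show "attainable r i u \<pi> (insert ?g ?C) v'"
          using own A by simp
        show "0 \<le> u x \<and> u x \<le> u ?g" if "x \<in> insert ?g (insert z ?C)" for x
          using that g own max Cons.prems(5) by auto
        show "insert ?g (insert z ?C) \<subseteq> set (r b)" if "b \<in> set \<pi>" for b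
          using that g own Cons.prems(4)[of b] by auto
      qed auto
      with A show ?thesis
        by simp
    qed
    then obtain w where w: "attainable r i u \<pi> (A - {?g}) w" "v' \<le> w + u ?g"
      by blast
    \<comment> \<open>Here \<open>v = u z + v'\<close> is at most \<open>u ?g + (w + u ?g)\<close>,
      and \<open>IH\<close> bounds \<open>w\<close>.\<close>
    show ?thesis
      using IH[OF w(1)] w(2) max[of z] own unfolding sum by simp
  next
    case other
    with IH show ?thesis
      unfolding sum by simp
  qed
qed

theorem theorem2:
  fixes n :: nat
    and Items :: "'a set"
    and \<pi> :: "nat list"
    and pref :: "nat \<Rightarrow> 'a list"
    and u :: "'a \<Rightarrow> real"
    and s :: "'a list"
  assumes "best_response n Items \<pi> pref u"
    and "optimal_strategy Items \<pi> pref u s"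
  shows "manipulator_utility Items \<pi> pref u (pref 1)
           \<ge> 1 / 2 * manipulator_utility Items \<pi> pref u s"
proof -
  interpret best_response n Items \<pi> pref u
    by fact
  have s: "set s = Items"
    using assms(2) by (auto simp: optimal_strategy_def is_arg_max_def permutations_of_set_def)
  have pref: "set (pref a) = Items" if "a \<in> {1..n}" for a
    using pref_ranking[OF that] by (simp add: permutations_of_set_def)
  have "attainable pref 1 u \<pi> Items (manipulator_utility Items \<pi> pref u s)"
    unfolding manipulator_utility_def manipulator_bundle_def
    using finite_Items policy_length policy_agents s pref
    by (intro agent_bundle_attainable) auto
  then have "manipulator_utility Items \<pi> pref u s \<le> 2 * sum u (agent_bundle pref \<pi> Items 1)"
  proof (rule attainable_le_twice_truthful)
    show "Items \<subseteq> set (pref a)" if "a \<in> set \<pi>" for a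
      using pref[of a] that policy_agents by auto
    show "u x \<le> u (first_available (pref 1) B)" if B: "B \<subseteq> Items" "x \<in> B" for B x
    \<comment> \<open>Consistency of \<open>u\<close> compares only distinct items, so equality is
      split off.\<close>
    proof (cases "x = first_available (pref 1) B")
      case False
      have sub: "B \<subseteq> set (pref 1)"
        using B pref[of 1] agents by auto
      then have "first_available (pref 1) B \<in> Items" "x \<in> Items"
        using B first_available_in[of B "pref 1"] by blast+
      with first_available_prefers[OF sub B(2) False] show ?thesis
        using u_consistent[of "first_available (pref 1) B" x] by simp
    qed simp
  qed (use finite_Items policy_length u_pos less_imp_le in auto)
  \<comment> \<open>Truthful play is \<open>pref(1 := pref 1)\<close>, which is \<open>pref\<close>
    itself.\<close>
  then show ?thesis
    by (simp add: manipulator_utility_def manipulator_bundle_def)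
qed

end
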